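(* Let $2\le l\le k$ and let \[ g(x_1,\dots,x_k)=\sum_{\{i_1,\dots,i_l\}\subset\{1,\dots,k\}}\ \prod_{j=1}^{l}x_{i_j} \] be the elementary symmetric polynomial of degree $l$ in $x_1,\dots,x_k$. Then the $\mathcal L_1$ component $g_1$ of $g$ has the form \[ g_1(x_1,\dots,x_k)=(x_1-\mu)(x_k-\mu)\,\widetilde g(x_2,\dots,x_{k-1}), \] where $\widetilde g$ is the elementary symmetric polynomial of degree $l-2$ in the intermediate variables $x_2,\dots,x_{k-1}$ (with the degree-$0$ elementary symmetric polynomial equal to $1$).
   Context: Let $\nu$ be a probability measure on $\mathbb R$ with finite second moment and mean $\mu$, let $\pi_k=\nu^{\otimes k}$, and let $\mathcal H_k$ be the Hilbert space of functions in $L^2(\mathbb R^k,\pi_k)$ with zero $\pi_k$-integral. Define $P$ on $\mathcal H_k$ by $Pf(x_1,\dots,x_k)=\int f(x_2,\dots,x_k,\xi)\,\nu(d\xi)$, let $P^*$ be its adjoint, and $B_k=I+P+P^*+\cdots+P^{k-1}+(P^* )^{k-1}$ (self-adjoint). $\mathcal L_1$ is the eigenspace of $B_k$ for eigenvalue $1$; equivalently, $\mathcal L_1$ is the set of $f\in\mathcal H_k$ with $\int f\,\nu(dx_1)=0$ and $\int f\,\nu(dx_k)=0$. The $\mathcal L_1$ component of a function $f\in\mathcal H_k$ is its orthogonal projection onto $\mathcal L_1$; the $\mathcal L_1$ component of $g\in L^2(\pi_k)$ means that of the centered function $g-\int g\,d\pi_k$ (here $\int g\,d\pi_k=\binom kl\mu^l$).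 *)

theory Defs
  imports "HOL-Probability.Probability"
begin

(* Elements of the L2 spaces are represented by square-integrable functions;
   equality of elements is equality almost everywhere. *)

definition L2_space :: "'a measure \<Rightarrow> ('a \<Rightarrow> real) set" where
  "L2_space M = {f \<in> borel_measurable M. integrable M (\<lambda>x. (f x)\<^sup>2)}"

definition L2_inner :: "'a measure \<Rightarrow> ('a \<Rightarrow> real) \<Rightarrow> ('a \<Rightarrow> real) \<Rightarrow> real" where
  "L2_inner M f g = (\<integral>x. f x * g x \<partial>M)"

definition L2_centered :: "'a measure \<Rightarrow> ('a \<Rightarrow> real) set" where
  "L2_centered M = {f \<in> L2_space M. (\<integral>x. f x \<partial>M) = 0}"

(* The adjoint of T on the centered space; its value at h is determined by the
   defining relation up to a null set, and the choice fixes a representative. *)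

definition L2_adjoint ::
    "'a measure \<Rightarrow> (('a \<Rightarrow> real) \<Rightarrow> 'a \<Rightarrow> real) \<Rightarrow> ('a \<Rightarrow> real) \<Rightarrow> 'a \<Rightarrow> real" where
  "L2_adjoint M T h = (SOME q. q \<in> L2_centered M \<and>
     (\<forall>f\<in>L2_centered M. L2_inner M (T f) h = L2_inner M f q))"

definition is_orth_proj ::
    "'a measure \<Rightarrow> ('a \<Rightarrow> real) set \<Rightarrow> ('a \<Rightarrow> real) \<Rightarrow> ('a \<Rightarrow> real) \<Rightarrow> bool" where
  "is_orth_proj M S f p \<longleftrightarrow> p \<in> S \<and> (\<forall>h\<in>S. L2_inner M (\<lambda>x. f x - p x) h = 0)"

(* Points of R^k are the extensional functions on {1..k}. *)

definition prod_law :: "nat \<Rightarrow> real measure \<Rightarrow> (nat \<Rightarrow> real) measure" where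
  "prod_law k \<nu> = PiM {1..k} (\<lambda>_. \<nu>)"

(* (x_1, ..., x_k), xi |-> (x_2, ..., x_k, xi) *)

definition shift_in :: "nat \<Rightarrow> (nat \<Rightarrow> real) \<Rightarrow> real \<Rightarrow> nat \<Rightarrow> real" where
  "shift_in k x \<xi> = (\<lambda>i\<in>{1..k}. if i < k then x (i + 1) else \<xi>)"

definition P_op :: "nat \<Rightarrow> real measure \<Rightarrow> ((nat \<Rightarrow> real) \<Rightarrow> real) \<Rightarrow> (nat \<Rightarrow> real) \<Rightarrow> real" where
  "P_op k \<nu> f = (\<lambda>x. \<integral>\<xi>. f (shift_in k x \<xi>) \<partial>\<nu>)"

definition P_adj :: "nat \<Rightarrow> real measure \<Rightarrow> ((nat \<Rightarrow> real) \<Rightarrow> real) \<Rightarrow> (nat \<Rightarrow> real) \<Rightarrow> real" where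
  "P_adj k \<nu> = L2_adjoint (prod_law k \<nu>) (P_op k \<nu>)"

definition B_op :: "nat \<Rightarrow> real measure \<Rightarrow> ((nat \<Rightarrow> real) \<Rightarrow> real) \<Rightarrow> (nat \<Rightarrow> real) \<Rightarrow> real" where
  "B_op k \<nu> f = (\<lambda>x. f x + (\<Sum>j\<in>{1..<k}. (P_op k \<nu> ^^ j) f x + (P_adj k \<nu> ^^ j) f x))"

definition B_eigenspace :: "nat \<Rightarrow> real measure \<Rightarrow> real \<Rightarrow> ((nat \<Rightarrow> real) \<Rightarrow> real) set" where
  "B_eigenspace k \<nu> c =
     {f \<in> L2_centered (prod_law k \<nu>). AE x in prod_law k \<nu>. B_op k \<nu> f x = c * f x}"

definition is_L1_component ::
    "nat \<Rightarrow> real measure \<Rightarrow> ((nat \<Rightarrow> real) \<Rightarrow> real) \<Rightarrow> ((nat \<Rightarrow> real) \<Rightarrow> real) \<Rightarrow> bool" where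
  "is_L1_component k \<nu> g p \<longleftrightarrow>
     g \<in> L2_space (prod_law k \<nu>) \<and>
     is_orth_proj (prod_law k \<nu>) (B_eigenspace k \<nu> 1)
       (\<lambda>x. g x - (\<integral>y. g y \<partial>prod_law k \<nu>)) p"

definition elem_sym :: "nat \<Rightarrow> nat set \<Rightarrow> (nat \<Rightarrow> real) \<Rightarrow> real" where
  "elem_sym l I x = (\<Sum>S\<in>{S. S \<subseteq> I \<and> card S = l}. \<Prod>i\<in>S. x i)"

end

(* Averaging over the dropped variable gives an explicit adjoint Q of P on centered functions, with
   P Q P = P, Q P Q = Q and P^k = Q^k = 0. If B f = f, then v = Q f + ... + Q^(k-1) f equals
   -(P f + ... + P^(k-1) f), whence Q v = v - Q f and P v = v + P f, so v lies in the ranges of both P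
   and Q and both operators preserve its norm. Expanding |P v|^2 = |v|^2 = |Q v|^2 forces
   P f = Q f = 0, which characterises the eigenspace L1. A function that does not depend on x_k is
   fixed by Q P and hence orthogonal to L1, and likewise for x_1 and P Q; the recursion of elementary
   symmetric polynomials writes g - g1 as a sum of two such functions. *)

theory Submission
  imports Defs
begin

section \<open>Square-integrable functions and their inner product\<close>

lemma L2_spaceD:
  assumes "f \<in> L2_space M"
  shows "f \<in> borel_measurable M" "integrable M (\<lambda>x. (f x)\<^sup>2)"
  using assms by (auto simp: L2_space_def)

lemma L2_mult_integrable:
  assumes "f \<in> L2_space M" "g \<in> L2_space M"
  shows "integrable M (\<lambda>x. f x * g x)"
proof (rule Bochner_Integration.integrable_bound)
  show "integrable M (\<lambda>x. (f x)\<^sup>2 + (g x)\<^sup>2)"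
    using assms by (auto simp: L2_space_def)
  show "(\<lambda>x. f x * g x) \<in> borel_measurable M"
    using assms by (auto simp: L2_space_def)
  have "\<bar>a * b\<bar> \<le> a\<^sup>2 + b\<^sup>2" for a b :: real
  proof -
    have "0 \<le> \<bar>a\<bar> * \<bar>b\<bar>" by simp
    then show ?thesis using sum_squares_bound[of "\<bar>a\<bar>" "\<bar>b\<bar>"] unfolding abs_mult power2_abs mult.assoc
      by linarith
  qed
  then show "AE x in M. norm (f x * g x) \<le> norm ((f x)\<^sup>2 + (g x)\<^sup>2)"
    by (auto intro!: AE_I2 order_trans[OF _ abs_ge_self])
qed

lemma L2_space_add:
  assumes "f \<in> L2_space M" "g \<in> L2_space M"
  shows "(\<lambda>x. f x + g x) \<in> L2_space M"
  using assms L2_mult_integrable[OF assms]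
  by (auto simp: L2_space_def power2_sum mult.assoc)

lemma L2_space_scale: "f \<in> L2_space M \<Longrightarrow> (\<lambda>x. c * f x) \<in> L2_space M"
  by (auto simp: L2_space_def power_mult_distrib)

lemma L2_space_diff:
  assumes "f \<in> L2_space M" "g \<in> L2_space M"
  shows "(\<lambda>x. f x - g x) \<in> L2_space M"
  using L2_space_add[OF assms(1) L2_space_scale[OF assms(2), of "-1"]] by simp

lemma L2_space_sum:
  assumes "\<And>i. i \<in> A \<Longrightarrow> f i \<in> L2_space M"
  shows "(\<lambda>x. \<Sum>i\<in>A. f i x) \<in> L2_space M"
proof (cases "finite A")
  case True
  then show ?thesis using assms
  proof (induction A rule: finite_induct)
    case empty
    then show ?case by (simp add: L2_space_def)
  next
    case (insert a A)
    then show ?case using L2_space_add[of "f a" M] by simp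
  qed
qed (simp add: L2_space_def)

lemma L2_inner_commute: "L2_inner M f g = L2_inner M g f"
  by (simp add: L2_inner_def mult.commute)

lemma L2_inner_add_left:
  assumes "f \<in> L2_space M" "g \<in> L2_space M" "h \<in> L2_space M"
  shows "L2_inner M (\<lambda>x. f x + g x) h = L2_inner M f h + L2_inner M g h"
  using L2_mult_integrable[OF assms(1,3)] L2_mult_integrable[OF assms(2,3)]
  by (simp add: L2_inner_def distrib_right)

lemma L2_inner_diff_left:
  assumes "f \<in> L2_space M" "g \<in> L2_space M" "h \<in> L2_space M"
  shows "L2_inner M (\<lambda>x. f x - g x) h = L2_inner M f h - L2_inner M g h"
  using L2_mult_integrable[OF assms(1,3)] L2_mult_integrable[OF assms(2,3)]
  by (simp add: L2_inner_def left_diff_distrib)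

lemma L2_inner_add_right:
  assumes "f \<in> L2_space M" "g \<in> L2_space M" "h \<in> L2_space M"
  shows "L2_inner M h (\<lambda>x. f x + g x) = L2_inner M h f + L2_inner M h g"
  using L2_inner_add_left[OF assms] by (simp only: L2_inner_commute)

lemma L2_inner_diff_right:
  assumes "f \<in> L2_space M" "g \<in> L2_space M" "h \<in> L2_space M"
  shows "L2_inner M h (\<lambda>x. f x - g x) = L2_inner M h f - L2_inner M h g"
  using L2_inner_diff_left[OF assms] by (simp only: L2_inner_commute)

lemma L2_inner_cong_AE:
  assumes "f \<in> L2_space M" "f' \<in> L2_space M" "g \<in> L2_space M" "g' \<in> L2_space M"
    and "AE x in M. f x = f' x" "AE x in M. g x = g' x"
  shows "L2_inner M f g = L2_inner M f' g'"
  unfolding L2_inner_def using assms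
  by (intro integral_cong_AE) (auto simp: L2_space_def)

lemma L2_inner_self_eq_0:
  assumes "f \<in> L2_space M" "L2_inner M f f = 0"
  shows "AE x in M. f x = 0"
  using assms integral_nonneg_eq_0_iff_AE[of M "\<lambda>x. (f x)\<^sup>2"]
  by (auto simp: L2_inner_def L2_space_def power2_eq_square)

lemma L2_centeredD: "f \<in> L2_centered M \<Longrightarrow> f \<in> L2_space M"
  by (simp add: L2_centered_def)

context prob_space
begin

lemma L2_integrable: "f \<in> L2_space M \<Longrightarrow> integrable M f"
  by (auto simp: L2_space_def intro: square_integrable_imp_integrable)

lemma L2_space_const: "(\<lambda>x. c) \<in> L2_space M"
  by (simp add: L2_space_def)

lemma L2_centered_diff:
  "f \<in> L2_centered M \<Longrightarrow> g \<in> L2_centered M \<Longrightarrow> (\<lambda>x. f x - g x) \<in> L2_centered M"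
  by (simp add: L2_centered_def L2_space_diff L2_integrable)

lemma L2_centered_sum:
  "(\<And>i. i \<in> A \<Longrightarrow> f i \<in> L2_centered M) \<Longrightarrow> (\<lambda>x. \<Sum>i\<in>A. f i x) \<in> L2_centered M"
  by (simp add: L2_centered_def L2_space_sum L2_integrable Bochner_Integration.integral_sum)

end

section \<open>Markov operators of measure-preserving random maps\<close>

definition random_avg :: "'b measure \<Rightarrow> ('a \<Rightarrow> 'b \<Rightarrow> 'a) \<Rightarrow> ('a \<Rightarrow> real) \<Rightarrow> 'a \<Rightarrow> real" where
  "random_avg N s f = (\<lambda>x. \<integral>\<xi>. f (s x \<xi>) \<partial>N)"

text \<open>A chain step x -> \<open>s x \<xi>\<close> driven by independent noise of law N. The
  condition \<open>distr_s\<close> says that M is stationary for the chain; Fubini together with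
  stationarity gives all the properties of the averaging operator A below.\<close>

locale random_map = prob_space M + N: prob_space N
  for M :: "'a measure" and N :: "'b measure" +
  fixes s :: "'a \<Rightarrow> 'b \<Rightarrow> 'a"
  assumes measurable_s [measurable]: "case_prod s \<in> M \<Otimes>\<^sub>M N \<rightarrow>\<^sub>M M"
    and distr_s: "distr (M \<Otimes>\<^sub>M N) M (case_prod s) = M"
begin

sublocale MN: pair_prob_space M N ..

abbreviation (input) A where "A \<equiv> random_avg N s"

lemma integrable_s:
  fixes f :: "'a \<Rightarrow> real"
  assumes "integrable M f"
  shows "integrable (M \<Otimes>\<^sub>M N) (\<lambda>p. f (case_prod s p))"
  using assms integrable_distr_eq[OF measurable_s, of f] by (simp add: distr_s)

lemma integral_s:
  fixes f :: "'a \<Rightarrow> real"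
  assumes "integrable M f"
  shows "integral\<^sup>L (M \<Otimes>\<^sub>M N) (\<lambda>p. f (case_prod s p)) = integral\<^sup>L M f"
  using assms integral_distr[OF measurable_s, of f] by (simp add: distr_s)

lemma AE_integrable_s:
  fixes f :: "'a \<Rightarrow> real"
  assumes "integrable M f"
  shows "AE x in M. integrable N (\<lambda>\<xi>. f (s x \<xi>))"
  using MN.AE_integrable_fst'[OF integrable_s[OF assms]] by simp

lemma integral_avg: "integrable M f \<Longrightarrow> integral\<^sup>L M (A f) = integral\<^sup>L M f"
  using MN.integral_fst'[OF integrable_s] integral_s by (simp add: random_avg_def)

lemma measurable_avg [measurable]:
  assumes [measurable]: "f \<in> borel_measurable M"
  shows "A f \<in> borel_measurable M"
  unfolding random_avg_def by measurable

text \<open>Jensen's inequality, taken from the nonnegativity of the variance of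
  \<open>f (s x \<xi>)\<close> at almost every x. The average of the square is integrable by Fubini
  and stationarity.\<close>

lemma avg_L2:
  assumes f: "f \<in> L2_space M"
  shows "A f \<in> L2_space M"
proof -
  note [measurable] = L2_spaceD(1)[OF f]
  have "integrable M (\<lambda>x. (A f x)\<^sup>2)"
  proof (rule Bochner_Integration.integrable_bound)
    show "integrable M (A (\<lambda>x. (f x)\<^sup>2))"
      using MN.integrable_fst'[OF integrable_s[OF L2_spaceD(2)[OF f]]]
      by (simp add: random_avg_def)
    show "(\<lambda>x. (A f x)\<^sup>2) \<in> borel_measurable M" by measurable
    show "AE x in M. norm ((A f x)\<^sup>2) \<le> norm (A (\<lambda>x. (f x)\<^sup>2) x)"
      using AE_integrable_s[OF L2_integrable[OF f]] AE_integrable_s[OF L2_spaceD(2)[OF f]]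
    proof eventually_elim
      case (elim x)
      have "(A f x)\<^sup>2 \<le> A (\<lambda>x. (f x)\<^sup>2) x"
        using N.variance_positive[of "\<lambda>\<xi>. f (s x \<xi>)"] N.variance_eq[OF elim]
        by (simp add: random_avg_def)
      then show ?case by simp
    qed
  qed
  then show ?thesis by (simp add: L2_space_def)
qed

lemma avg_centered: "f \<in> L2_centered M \<Longrightarrow> A f \<in> L2_centered M"
  using avg_L2 integral_avg L2_integrable by (auto simp: L2_centered_def)

lemma avg_pow_centered: "f \<in> L2_centered M \<Longrightarrow> (A ^^ n) f \<in> L2_centered M"
  by (induction n) (auto intro: avg_centered)

text \<open>By stationarity the preimage of an M-null set under \<open>case_prod s\<close> is null
  in the product, so almost every section of it is N-null.\<close>

lemma avg_cong_AE:
  assumes [measurable]: "f \<in> borel_measurable M" "g \<in> borel_measurable M"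
    and "AE x in M. f x = g x"
  shows "AE x in M. A f x = A g x"
proof -
  have "AE p in M \<Otimes>\<^sub>M N. f (case_prod s p) = g (case_prod s p)"
    using assms(3) by (intro AE_distrD[OF measurable_s]) (simp only: distr_s)
  from MN.AE_pair[OF this] AE_space show ?thesis
    by eventually_elim (auto simp: random_avg_def intro!: integral_cong_AE)
qed

text \<open>Linearity is claimed almost everywhere: at an exceptional x a section need not be
  N-integrable, and its integral then takes the default value 0.\<close>

lemma avg_add:
  assumes "integrable M f" "integrable M g"
  shows "AE x in M. A (\<lambda>x. f x + g x) x = A f x + A g x"
  using assms[THEN AE_integrable_s]
  by eventually_elim (simp add: random_avg_def)

lemma avg_diff:
  assumes "integrable M f" "integrable M g"
  shows "AE x in M. A (\<lambda>x. f x - g x) x = A f x - A g x"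
  using assms[THEN AE_integrable_s]
  by eventually_elim (simp add: random_avg_def)

lemma avg_sum:
  assumes "finite I" "\<And>i. i \<in> I \<Longrightarrow> integrable M (f i)"
  shows "AE x in M. A (\<lambda>x. \<Sum>i\<in>I. f i x) x = (\<Sum>i\<in>I. A (f i) x)"
proof -
  have "AE x in M. \<forall>i\<in>I. integrable N (\<lambda>\<xi>. f i (s x \<xi>))"
    using assms AE_integrable_s by (simp add: AE_finite_all)
  then show ?thesis
    by eventually_elim (simp add: random_avg_def Bochner_Integration.integral_sum)
qed

text \<open>Writing the inner product as one integral over the product space lets a later change of
  variables prove adjointness. Both factors are square-integrable on the product, so Fubini
  applies.\<close>

lemma avg_inner:
  assumes f: "f \<in> L2_space M" and h: "h \<in> L2_space M"
  shows "L2_inner M (A f) h = (\<integral>p. f (case_prod s p) * h (fst p) \<partial>(M \<Otimes>\<^sub>M N))"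
proof -
  note [measurable] = L2_spaceD(1)[OF f] L2_spaceD(1)[OF h]
  have "(\<lambda>p. f (case_prod s p)) \<in> L2_space (M \<Otimes>\<^sub>M N)"
    using integrable_s[OF L2_spaceD(2)[OF f]] by (simp add: L2_space_def)
  moreover have "integrable (M \<Otimes>\<^sub>M N) (\<lambda>p. (h (fst p))\<^sup>2)"
    using integrable_distr_eq[of fst "M \<Otimes>\<^sub>M N" M "\<lambda>x. (h x)\<^sup>2"] L2_spaceD(2)[OF h]
    by (simp add: N.distr_pair_fst)
  then have "(\<lambda>p. h (fst p)) \<in> L2_space (M \<Otimes>\<^sub>M N)"
    by (simp add: L2_space_def)
  ultimately have "integrable (M \<Otimes>\<^sub>M N) (\<lambda>p. f (case_prod s p) * h (fst p))"
    by (rule L2_mult_integrable)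
  from MN.integral_fst'[OF this] show ?thesis
    by (simp add: L2_inner_def random_avg_def)
qed

lemma avg_pow_AE_eq_0:
  assumes f: "f \<in> L2_centered M" and "AE x in M. A f x = 0" and "0 < j"
  shows "AE x in M. (A ^^ j) f x = 0"
  using \<open>0 < j\<close>
proof (induction j rule: nat_induct_non_zero)
  case (Suc j)
  have "AE x in M. A ((A ^^ j) f) x = A (\<lambda>_. 0) x"
    using Suc avg_pow_centered[OF f, of j]
    by (intro avg_cong_AE) (auto intro: L2_spaceD(1) L2_centeredD)
  moreover have "A (\<lambda>_. 0) = (\<lambda>_. 0)" by (simp add: random_avg_def fun_eq_iff)
  ultimately show ?case by simp
qed (use assms in simp)

text \<open>Telescoping: applying A raises each power in v by one, the new top power n vanishes by
  nilpotency, and the only term lost is A f.\<close>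

lemma avg_pow_sum:
  assumes f: "f \<in> L2_centered M" and "0 < n" and nil: "(A ^^ n) f = (\<lambda>_. 0)"
  defines "v \<equiv> \<lambda>x. \<Sum>j\<in>{1..<n}. (A ^^ j) f x"
  shows "v \<in> L2_centered M" "AE x in M. v x = A v x + A f x"
proof -
  show "v \<in> L2_centered M"
    unfolding v_def by (intro L2_centered_sum avg_pow_centered f)
  have "AE x in M. A v x = (\<Sum>j\<in>{1..<n}. A ((A ^^ j) f) x)"
    unfolding v_def
    by (intro avg_sum L2_integrable L2_centeredD avg_pow_centered f) auto
  then show "AE x in M. v x = A v x + A f x"
  proof eventually_elim
    case (elim x)
    have "A v x = (\<Sum>j\<in>{1..<n}. (A ^^ Suc j) f x)" using elim by simp
    also have "\<dots> = (\<Sum>j\<in>{Suc 1..<Suc n}. (A ^^ j) f x)"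
      by (simp only: sum.atLeast_Suc_lessThan_Suc_shift comp_def)
    also have "A f x + \<dots> = (\<Sum>j\<in>{1..<Suc n}. (A ^^ j) f x)"
      using \<open>0 < n\<close> by (subst (2) sum.atLeast_Suc_lessThan) auto
    also have "\<dots> = v x" using \<open>0 < n\<close> nil by (simp add: v_def)
    finally show ?case by simp
  qed
qed

end

section \<open>Adjoint pairs of nilpotent averaging operators\<close>

locale adjoint_random_maps =
  S: random_map M N s + T: random_map M N t
  for M :: "'a measure" and N :: "'b measure" and s t :: "'a \<Rightarrow> 'b \<Rightarrow> 'a" +
  fixes n :: nat
  assumes adjoint: "f \<in> L2_space M \<Longrightarrow> h \<in> L2_space M \<Longrightarrow>
      L2_inner M (random_avg N s f) h = L2_inner M f (random_avg N t h)"
    and STS: "random_avg N s (random_avg N t (random_avg N s f)) = random_avg N s f"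
    and TST: "random_avg N t (random_avg N s (random_avg N t f)) = random_avg N t f"
    and n_pos: "0 < n"
    and nilpotent: "f \<in> L2_centered M \<Longrightarrow> (random_avg N s ^^ n) f = (\<lambda>_. 0)"
      "f \<in> L2_centered M \<Longrightarrow> (random_avg N t ^^ n) f = (\<lambda>_. 0)"
begin

abbreviation (input) P where "P \<equiv> random_avg N s"
abbreviation (input) Q where "Q \<equiv> random_avg N t"

text \<open>The hard half of the description of the eigenspace. The hypothesis reads w = -v, so the
  two telescoping identities express both P v and Q v through v and f.\<close>

lemma avg_eq_0_if_power_sum_eq_0:
  assumes f: "f \<in> L2_centered M"
    and sum0: "AE x in M. (\<Sum>j\<in>{1..<n}. (P ^^ j) f x + (Q ^^ j) f x) = 0"
  shows "AE x in M. P f x = 0" "AE x in M. Q f x = 0"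
proof -
  define v where "v = (\<lambda>x. \<Sum>j\<in>{1..<n}. (Q ^^ j) f x)"
  define w where "w = (\<lambda>x. \<Sum>j\<in>{1..<n}. (P ^^ j) f x)"
  let ?ip = "L2_inner M"
  have "v \<in> L2_centered M" and v_eq: "AE x in M. v x = Q v x + Q f x"
    unfolding v_def by (rule T.avg_pow_sum[OF f n_pos nilpotent(2)[OF f]])+
  have "w \<in> L2_centered M" and w_eq: "AE x in M. w x = P w x + P f x"
    unfolding w_def by (rule S.avg_pow_sum[OF f n_pos nilpotent(1)[OF f]])+
  have L2: "f \<in> L2_space M" "v \<in> L2_space M" "w \<in> L2_space M"
    using f \<open>v \<in> _\<close> \<open>w \<in> _\<close> by (auto intro: L2_centeredD)
  note L2s = L2 S.avg_L2 T.avg_L2 L2_space_add L2_space_diff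
  note int = S.L2_integrable
  note bm = L2_spaceD(1)
  \<comment> \<open>The negative is written as a difference from 0 so that \<open>S.avg_diff\<close>
    carries it through P.\<close>
  have wv: "AE x in M. w x = 0 - v x"
    using sum0 by eventually_elim (simp add: v_def w_def sum.distrib)
  have Pw: "AE x in M. P w x = P (\<lambda>x. 0 - v x) x"
    by (intro S.avg_cong_AE wv bm L2s S.L2_space_const)
  have Pv0: "AE x in M. P (\<lambda>x. 0 - v x) x = P (\<lambda>_. 0) x - P v x"
    by (intro S.avg_diff int L2s S.L2_space_const)
  have Pv: "AE x in M. P v x = v x + P f x"
    using wv w_eq Pw Pv0 by eventually_elim (simp add: random_avg_def)
  have Qv: "AE x in M. Q v x = v x - Q f x"
    using v_eq by eventually_elim simp
  \<comment> \<open>Here v is exhibited in both ranges. By \<open>STS\<close> the product P Q is the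
    identity on the range of P, and by \<open>TST\<close> Q P is the identity on the range of Q, so
    both products fix v.\<close>
  have vP: "AE x in M. v x = P (\<lambda>x. v x - f x) x"
    using S.avg_diff[OF int int, OF L2(2,1)] Pv by eventually_elim simp
  have vQ: "AE x in M. v x = Q (\<lambda>x. v x + f x) x"
    using T.avg_add[OF int int, OF L2(2,1)] Qv by eventually_elim simp
  have PQ_cong: "AE x in M. P (Q g) x = P (Q h) x"
    if "AE x in M. g x = h x" "g \<in> L2_space M" "h \<in> L2_space M" for g h
    using that by (intro S.avg_cong_AE T.avg_cong_AE bm L2s) auto
  have QP_cong: "AE x in M. Q (P g) x = Q (P h) x"
    if "AE x in M. g x = h x" "g \<in> L2_space M" "h \<in> L2_space M" for g h
    using that by (intro S.avg_cong_AE T.avg_cong_AE bm L2s) auto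
  have PQv: "AE x in M. P (Q v) x = v x"
    using PQ_cong[OF vP] vP by (auto simp: STS L2s)
  have QPv: "AE x in M. Q (P v) x = v x"
    using QP_cong[OF vQ] vQ by (auto simp: TST L2s)
  have Qf: "AE x in M. Q f x = v x - Q v x" using Qv by eventually_elim simp
  have Pf: "AE x in M. P f x = P v x - v x" using Pv by eventually_elim simp
  \<comment> \<open>Substituting Q f = v - Q v gives P Q f = P v - P Q v = P v - v = P f; the next
    fact is the mirror image.\<close>
  have PQf: "AE x in M. P (Q f) x = P f x"
  proof -
    have "AE x in M. P (Q f) x = P (\<lambda>x. v x - Q v x) x"
      by (intro S.avg_cong_AE Qf bm L2s)
    moreover have "AE x in M. P (\<lambda>x. v x - Q v x) x = P v x - P (Q v) x"
      by (intro S.avg_diff int L2s)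
    ultimately show ?thesis using PQv Pf by eventually_elim simp
  qed
  have QPf: "AE x in M. Q (P f) x = Q f x"
  proof -
    have "AE x in M. Q (P f) x = Q (\<lambda>x. P v x - v x) x"
      by (intro T.avg_cong_AE Pf bm L2s)
    moreover have "AE x in M. Q (\<lambda>x. P v x - v x) x = Q (P v) x - Q v x"
      by (intro T.avg_diff int L2s)
    ultimately show ?thesis using QPv Qf by eventually_elim simp
  qed
  \<comment> \<open>One number measures everything: <Qf,Qf> = <PQf,f> = <Pf,f> = a, and <Pf,Pf> =
    <f,QPf> = <f,Qf> = <Pf,f> = a. In the same way P Q v = v = Q P v shows that P and Q preserve the
    norm of v.\<close>
  define a where "a = ?ip (P f) f"
  have Qf_norm: "?ip (Q f) (Q f) = a"
    using L2_inner_cong_AE[OF _ _ _ _ PQf, of f f] adjoint[of "Q f" f]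
    by (simp add: L2s a_def)
  have Pf_norm: "?ip (P f) (P f) = a"
    using L2_inner_cong_AE[OF _ _ _ _ _ QPf, of f f] adjoint[of f "P f"] adjoint[of f f]
    by (simp add: L2s a_def)
  have Qv_norm: "?ip (Q v) (Q v) = ?ip v v"
    using L2_inner_cong_AE[OF _ _ _ _ PQv, of v v] adjoint[of "Q v" v]
    by (simp add: L2s)
  have Pv_norm: "?ip (P v) (P v) = ?ip v v"
    using L2_inner_cong_AE[OF _ _ _ _ _ QPv, of v v] adjoint[of v "P v"]
    by (simp add: L2s)
  have 1: "?ip (P v) (P v) = ?ip v v + 2 * ?ip (P f) v + a"
  proof -
    have "?ip (P v) (P v) = ?ip (\<lambda>x. v x + P f x) (\<lambda>x. v x + P f x)"
      by (intro L2_inner_cong_AE Pv L2s)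
    then show ?thesis
      by (simp add: L2_inner_add_left L2_inner_add_right
          L2s Pf_norm L2_inner_commute[of _ v "P f"])
  qed
  have 2: "?ip (Q v) (Q v) = ?ip v v - 2 * ?ip (Q f) v + a"
  proof -
    have "?ip (Q v) (Q v) = ?ip (\<lambda>x. v x - Q f x) (\<lambda>x. v x - Q f x)"
      by (intro L2_inner_cong_AE Qv L2s)
    then show ?thesis
      by (simp add: L2_inner_diff_left L2_inner_diff_right
          L2s Qf_norm L2_inner_commute[of _ v "Q f"])
  qed
  \<comment> \<open>Adjointness moves the operator from f to v, where the formulas for Q v and P v
    apply.\<close>
  have 3: "?ip (P f) v = ?ip v f - a"
  proof -
    have "?ip (P f) v = ?ip (Q v) f"
      using adjoint[of f v] by (simp add: L2s L2_inner_commute[of _ f "Q v"])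
    also have "\<dots> = ?ip (\<lambda>x. v x - Q f x) f"
      by (intro L2_inner_cong_AE Qv L2s AE_I2 refl)
    also have "\<dots> = ?ip v f - ?ip f (Q f)"
      by (simp add: L2_inner_diff_left L2s L2_inner_commute[of _ "Q f" f])
    finally show ?thesis using adjoint[of f f] by (simp add: a_def L2s)
  qed
  have 4: "?ip (Q f) v = ?ip v f + a"
  proof -
    have "?ip (Q f) v = ?ip (P v) f"
      using adjoint[of v f] by (simp add: L2s L2_inner_commute[of _ v "Q f"])
    also have "\<dots> = ?ip (\<lambda>x. v x + P f x) f"
      by (intro L2_inner_cong_AE Pv L2s AE_I2 refl)
    finally show ?thesis by (simp add: L2_inner_add_left L2s a_def)
  qed
  \<comment> \<open>The P side yields 2<v,f> = a and the Q side 2<v,f> = -a.\<close>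
  have "a = 0"
    using 1 2 3 4 Pv_norm Qv_norm by simp
  with Pf_norm Qf_norm show "AE x in M. P f x = 0" "AE x in M. Q f x = 0"
    by (auto intro: L2_inner_self_eq_0 L2s)
qed

end

section \<open>Shifts of an i.i.d. window and their averages\<close>

lemma distr_PiM_insert:
  assumes "prob_space N"
  shows "distr (PiM I (\<lambda>_. N) \<Otimes>\<^sub>M N) (PiM (insert i I) (\<lambda>_. N)) (\<lambda>(x, \<xi>). x(i := \<xi>))
    = PiM (insert i I) (\<lambda>_. N)"
proof -
  interpret N: prob_space N by fact
  interpret I: product_prob_space "\<lambda>_. N" I ..
  interpret IN: pair_prob_space "PiM I (\<lambda>_. N)" N ..
  \<comment> \<open>Swapping the factors brings the new coordinate to the front, the form in which
    \<open>distr_pair_PiM_eq_PiM\<close> applies.\<close>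
  have "distr (PiM I (\<lambda>_. N) \<Otimes>\<^sub>M N) (PiM (insert i I) (\<lambda>_. N)) (\<lambda>(x, \<xi>). x(i := \<xi>))
      = distr (N \<Otimes>\<^sub>M PiM I (\<lambda>_. N)) (PiM (insert i I) (\<lambda>_. N)) (\<lambda>(\<xi>, x). x(i := \<xi>))"
    by (subst IN.distr_pair_swap, subst distr_distr) (auto simp: comp_def case_prod_beta
        intro!: measurable_fun_upd[where J=I] distr_cong)
  then show ?thesis
    using distr_pair_PiM_eq_PiM[of I "\<lambda>_. N" i] assms by simp
qed

text \<open>The shift opposite to \<open>shift_in\<close>: the fresh value enters in front and x_k
  drops out. Averaging over the fresh value will be the explicit adjoint Q.\<close>

definition shift_out :: "nat \<Rightarrow> (nat \<Rightarrow> real) \<Rightarrow> real \<Rightarrow> nat \<Rightarrow> real" where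
  "shift_out k x \<xi> = (\<lambda>i\<in>{1..k}. if i = 1 then \<xi> else x (i - 1))"

locale iid_window = real_distribution \<nu> for \<nu> :: "real measure" +
  fixes k :: nat
  assumes k_pos: "0 < k"
begin

abbreviation (input) "M \<equiv> prod_law k \<nu>"
abbreviation (input) "P \<equiv> random_avg \<nu> (shift_in k)"
abbreviation (input) "Q \<equiv> random_avg \<nu> (shift_out k)"

lemma P_op_eq: "P_op k \<nu> = P"
  by (simp add: fun_eq_iff P_op_def random_avg_def)

sublocale W: product_prob_space "\<lambda>_. \<nu>" "{1..k}" ..

sublocale W: prob_space M
  unfolding prod_law_def by (rule W.P.prob_space_axioms)

sublocale WN: pair_prob_space M \<nu> ..

lemma space_M: "space M = PiE {1..k} (\<lambda>_. UNIV)"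
  by (simp add: prod_law_def space_PiM)

text \<open>For i.i.d. \<open>X\<^sub>1, \<dots>, X\<^sub>k\<^sub>+\<^sub>1\<close> this map sends \<open>((X\<^sub>1, \<dots>, X\<^sub>k), X\<^sub>k\<^sub>+\<^sub>1)\<close> to
  \<open>((X\<^sub>2, \<dots>, X\<^sub>k\<^sub>+\<^sub>1), X\<^sub>1)\<close>. That it preserves the law yields the invariance of both shifts and
  the adjointness of \<open>P\<close> and \<open>Q\<close>.\<close>

definition rotate_in :: "(nat \<Rightarrow> real) \<times> real \<Rightarrow> (nat \<Rightarrow> real) \<times> real" where
  "rotate_in = (\<lambda>(x, \<xi>). (shift_in k x \<xi>, x 1))"

lemma measurable_shift_in [measurable]: "case_prod (shift_in k) \<in> M \<Otimes>\<^sub>M \<nu> \<rightarrow>\<^sub>M M"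
proof -
  have [measurable]: "i \<in> {1..k} \<Longrightarrow> (\<lambda>x. x i) \<in> M \<rightarrow>\<^sub>M \<nu>" for i
    unfolding prod_law_def by simp
  have "(\<lambda>p. \<lambda>i\<in>{1..k}. if i < k then fst p (i + 1) else snd p) \<in> M \<Otimes>\<^sub>M \<nu> \<rightarrow>\<^sub>M PiM {1..k} (\<lambda>_. \<nu>)"
  proof (rule measurable_restrict)
    fix i assume "i \<in> {1..k}"
    then show "(\<lambda>p. if i < k then fst p (i + 1) else snd p) \<in> M \<Otimes>\<^sub>M \<nu> \<rightarrow>\<^sub>M \<nu>"
      by (cases "i < k") auto
  qed
  then show ?thesis
    by (simp add: shift_in_def case_prod_beta' prod_law_def)
qed

lemma measurable_shift_out [measurable]: "case_prod (shift_out k) \<in> M \<Otimes>\<^sub>M \<nu> \<rightarrow>\<^sub>M M"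
proof -
  have [measurable]: "i \<in> {1..k} \<Longrightarrow> (\<lambda>x. x i) \<in> M \<rightarrow>\<^sub>M \<nu>" for i
    unfolding prod_law_def by simp
  have "(\<lambda>p. \<lambda>i\<in>{1..k}. if i = 1 then snd p else fst p (i - 1)) \<in> M \<Otimes>\<^sub>M \<nu> \<rightarrow>\<^sub>M PiM {1..k} (\<lambda>_. \<nu>)"
  proof (rule measurable_restrict)
    fix i assume "i \<in> {1..k}"
    then have "i \<noteq> 1 \<Longrightarrow> i - 1 \<in> {1..k}" by auto
    then show "(\<lambda>p. if i = 1 then snd p else fst p (i - 1)) \<in> M \<Otimes>\<^sub>M \<nu> \<rightarrow>\<^sub>M \<nu>"
      by (cases "i = 1") (simp_all del: One_nat_def)
  qed
  then show ?thesis
    by (simp add: shift_out_def case_prod_beta' prod_law_def)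
qed

lemma measurable_rotate_in [measurable]: "rotate_in \<in> M \<Otimes>\<^sub>M \<nu> \<rightarrow>\<^sub>M M \<Otimes>\<^sub>M \<nu>"
proof -
  have [measurable]: "(\<lambda>x. x 1) \<in> M \<rightarrow>\<^sub>M \<nu>"
    unfolding prod_law_def using k_pos by simp
  show ?thesis
    unfolding rotate_in_def by measurable
qed

text \<open>The rotation is composed of three law-preserving maps: append the new value as
  coordinate k + 1 (\<open>up\<close>), lower all indices by one, from {1..k+1} to {0..k}
  (\<open>lower\<close>), and separate coordinate 0, which now holds x_1
  (\<open>split\<close>).\<close>

lemma distr_rotate_in: "distr (M \<Otimes>\<^sub>M \<nu>) (M \<Otimes>\<^sub>M \<nu>) rotate_in = M \<Otimes>\<^sub>M \<nu>"
proof -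
  let ?K = "insert (Suc k) {1..k}"
  define up where "up = (\<lambda>(x :: nat \<Rightarrow> real, \<xi> :: real). x(Suc k := \<xi>))"
  define lower where "lower = (\<lambda>\<omega> :: nat \<Rightarrow> real. \<lambda>i\<in>insert 0 {1..k}. \<omega> (Suc i))"
  define split where "split = (\<lambda>\<omega> :: nat \<Rightarrow> real. (restrict \<omega> {1..k}, \<omega> 0))"
  define ins where "ins = (\<lambda>(x :: nat \<Rightarrow> real, \<xi> :: real). x(0 := \<xi>))"
  let ?N = "PiM (insert 0 {1..k}) (\<lambda>_. \<nu>)" and ?N' = "PiM ?K (\<lambda>_. \<nu>)"
  have up: "distr (M \<Otimes>\<^sub>M \<nu>) ?N' up = ?N'"
    unfolding up_def prod_law_def by (rule distr_PiM_insert) unfold_locales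
  have ins: "distr (M \<Otimes>\<^sub>M \<nu>) ?N ins = ?N"
    unfolding ins_def prod_law_def by (rule distr_PiM_insert) unfold_locales
  have lower: "distr ?N' ?N lower = ?N"
    unfolding lower_def
    by (rule distr_PiM_reindex) (auto intro: prob_space_axioms)
  have [measurable]: "up \<in> M \<Otimes>\<^sub>M \<nu> \<rightarrow>\<^sub>M ?N'" "ins \<in> M \<Otimes>\<^sub>M \<nu> \<rightarrow>\<^sub>M ?N"
    unfolding up_def ins_def prod_law_def case_prod_beta'
    by (auto intro!: measurable_fun_upd[where J="{1..k}"])
  have [measurable]: "lower \<in> ?N' \<rightarrow>\<^sub>M ?N"
    unfolding lower_def
    by (rule measurable_restrict, rule measurable_component_singleton) auto
  have [measurable]: "split \<in> ?N \<rightarrow>\<^sub>M M \<Otimes>\<^sub>M \<nu>"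
    unfolding split_def prod_law_def
    by (intro measurable_Pair measurable_restrict_subset measurable_component_singleton) auto
  \<comment> \<open>The law under \<open>split\<close> is found through its right inverse
    \<open>ins\<close>, which inserts coordinate 0 and preserves the law.\<close>
  have "distr ?N (M \<Otimes>\<^sub>M \<nu>) split = distr (M \<Otimes>\<^sub>M \<nu>) (M \<Otimes>\<^sub>M \<nu>) (split \<circ> ins)"
    by (subst ins[symmetric], subst distr_distr) (simp_all del: One_nat_def)
  also have "\<dots> = distr (M \<Otimes>\<^sub>M \<nu>) (M \<Otimes>\<^sub>M \<nu>) (\<lambda>p. p)"
  proof (rule distr_cong)
    fix p assume "p \<in> space (M \<Otimes>\<^sub>M \<nu>)"
    then have "fst p \<in> extensional {1..k}"
      by (auto simp: space_pair_measure space_M PiE_def)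
    moreover have "restrict ((fst p)(0 := snd p)) {1..k} = restrict (fst p) {1..k}"
      by (auto simp: fun_eq_iff restrict_def)
    ultimately show "(split \<circ> ins) p = p"
      by (simp add: split_def ins_def case_prod_beta extensional_restrict)
  qed auto
  finally have split: "distr ?N (M \<Otimes>\<^sub>M \<nu>) split = M \<Otimes>\<^sub>M \<nu>" by simp
  have "distr (M \<Otimes>\<^sub>M \<nu>) (M \<Otimes>\<^sub>M \<nu>) rotate_in
      = distr (M \<Otimes>\<^sub>M \<nu>) (M \<Otimes>\<^sub>M \<nu>) (split \<circ> (lower \<circ> up))"
  proof (rule distr_cong)
    fix p
    show "rotate_in p = (split \<circ> (lower \<circ> up)) p"
      using k_pos by (auto simp: rotate_in_def split_def lower_def up_def shift_in_def fun_eq_iff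
          split: prod.split)
  qed auto
  also have "\<dots> = distr (distr (distr (M \<Otimes>\<^sub>M \<nu>) ?N' up) ?N lower) (M \<Otimes>\<^sub>M \<nu>) split"
    by (subst distr_distr, measurable, subst distr_distr, measurable) (simp add: comp_assoc)
  finally show ?thesis by (simp only: up lower split)
qed

text \<open>The second component of \<open>rotate_in\<close> keeps exactly the value lost by the
  shift. Points of the space are extensional, which gives agreement outside {1..k}.\<close>

lemma shift_out_rotate_in:
  "x \<in> space M \<Longrightarrow> shift_out k (shift_in k x \<xi>) (x 1) = x"
  using k_pos by (fastforce simp: shift_out_def shift_in_def fun_eq_iff space_M PiE_def extensional_def)

sublocale S: random_map M \<nu> "shift_in k"
proof
  have "distr (M \<Otimes>\<^sub>M \<nu>) M (fst \<circ> rotate_in) = distr (distr (M \<Otimes>\<^sub>M \<nu>) (M \<Otimes>\<^sub>M \<nu>) rotate_in) M fst"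
    by (subst distr_distr) auto
  also have "\<dots> = M"
    by (simp add: distr_rotate_in distr_pair_fst)
  also have "fst \<circ> rotate_in = case_prod (shift_in k)"
    by (auto simp: rotate_in_def)
  finally show "distr (M \<Otimes>\<^sub>M \<nu>) M (case_prod (shift_in k)) = M" .
qed measurable

sublocale T: random_map M \<nu> "shift_out k"
proof
  \<comment> \<open>Preceded by the law-preserving \<open>rotate_in\<close>, the outward shift
    becomes the projection \<open>fst\<close>.\<close>
  have "distr (M \<Otimes>\<^sub>M \<nu>) M (case_prod (shift_out k))
      = distr (distr (M \<Otimes>\<^sub>M \<nu>) (M \<Otimes>\<^sub>M \<nu>) rotate_in) M (case_prod (shift_out k))"
    by (simp add: distr_rotate_in)
  also have "\<dots> = distr (M \<Otimes>\<^sub>M \<nu>) M (case_prod (shift_out k) \<circ> rotate_in)"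
    by (subst distr_distr) auto
  also have "\<dots> = distr (M \<Otimes>\<^sub>M \<nu>) M fst"
    by (rule distr_cong) (auto simp: rotate_in_def space_pair_measure shift_out_rotate_in
        simp del: One_nat_def)
  finally show "distr (M \<Otimes>\<^sub>M \<nu>) M (case_prod (shift_out k)) = M"
    by (simp add: distr_pair_fst)
qed measurable

text \<open>Change of variables along \<open>rotate_in\<close> in the product integral for <f, Q h>:
  the outward shift turns into the identity and the argument of f into the inward shift.\<close>

lemma inner_P_Q:
  assumes f: "f \<in> L2_space M" and h: "h \<in> L2_space M"
  shows "L2_inner M (P f) h = L2_inner M f (Q h)"
proof -
  note [measurable] = L2_spaceD(1)[OF f] L2_spaceD(1)[OF h]
  have "L2_inner M f (Q h) = (\<integral>p. h (case_prod (shift_out k) p) * f (fst p) \<partial>(M \<Otimes>\<^sub>M \<nu>))"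
    by (simp add: L2_inner_commute[of M f] T.avg_inner f h)
  also have "\<dots> = (\<integral>p. h (case_prod (shift_out k) p) * f (fst p)
      \<partial>distr (M \<Otimes>\<^sub>M \<nu>) (M \<Otimes>\<^sub>M \<nu>) rotate_in)"
    by (simp add: distr_rotate_in)
  also have "\<dots> = (\<integral>p. h (case_prod (shift_out k) (rotate_in p)) * f (fst (rotate_in p)) \<partial>(M \<Otimes>\<^sub>M \<nu>))"
    by (rule integral_distr) measurable
  also have "\<dots> = (\<integral>p. f (case_prod (shift_in k) p) * h (fst p) \<partial>(M \<Otimes>\<^sub>M \<nu>))"
    by (rule Bochner_Integration.integral_cong)
       (auto simp: rotate_in_def space_pair_measure shift_out_rotate_in mult.commute
         simp del: One_nat_def)
  also have "\<dots> = L2_inner M (P f) h"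
    by (simp add: S.avg_inner f h)
  finally show ?thesis ..
qed

text \<open>The value \<open>\<eta>\<close> brought in at the front is the one pushed out next, so Q
  P just integrates out x_k. Likewise P Q below integrates out x_1.\<close>

lemma QP_eq: "Q (P f) x = (\<integral>\<xi>. f (\<lambda>i\<in>{1..k}. if i < k then x i else \<xi>) \<partial>\<nu>)"
proof -
  have "shift_in k (shift_out k x \<eta>) \<xi> = (\<lambda>i\<in>{1..k}. if i < k then x i else \<xi>)" for \<eta> \<xi>
    by (auto simp: shift_in_def shift_out_def fun_eq_iff)
  then show ?thesis
    using prob_space by (simp add: random_avg_def)
qed

lemma PQ_eq: "P (Q f) x = (\<integral>\<xi>. f (\<lambda>i\<in>{1..k}. if i = 1 then \<xi> else x i) \<partial>\<nu>)"
proof -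
  have "shift_out k (shift_in k x \<eta>) \<xi> = (\<lambda>i\<in>{1..k}. if i = 1 then \<xi> else x i)" for \<eta> \<xi>
    by (auto simp: shift_in_def shift_out_def fun_eq_iff)
  then show ?thesis
    using prob_space by (simp add: random_avg_def)
qed

text \<open>After an inward shift, resampling the last coordinate only replaces the value just
  inserted, over which P averages anyway.\<close>

lemma PQP: "P (Q (P f)) = P f"
proof
  fix x
  have "(\<lambda>i\<in>{1..k}. if i < k then shift_in k x \<eta> i else \<xi>) = shift_in k x \<xi>" for \<eta> \<xi>
    by (auto simp: shift_in_def fun_eq_iff)
  then have "Q (P f) (shift_in k x \<eta>) = P f x" for \<eta>
    unfolding QP_eq by (simp add: random_avg_def)
  then show "P (Q (P f)) x = P f x"
    using prob_space by (subst random_avg_def) simp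
qed

lemma QPQ: "Q (P (Q f)) = Q f"
proof
  fix x
  have "(\<lambda>i\<in>{1..k}. if i = 1 then \<xi> else shift_out k x \<eta> i) = shift_out k x \<xi>" for \<eta> \<xi>
    by (auto simp: shift_out_def fun_eq_iff)
  then have "P (Q f) (shift_out k x \<eta>) = Q f x" for \<eta>
    unfolding PQ_eq by (simp add: random_avg_def)
  then show "Q (P (Q f)) x = Q f x"
    using prob_space by (subst random_avg_def) simp
qed

text \<open>Each application of P forgets one more leading coordinate, so k of them leave a
  constant. The exponent is \<open>Suc j\<close> because f itself may depend on values of x outside
  {1..k}, which a single shift erases.\<close>

lemma P_pow_cong:
  assumes "\<And>i. Suc j < i \<Longrightarrow> i \<le> k \<Longrightarrow> x i = y i"
  shows "(P ^^ Suc j) f x = (P ^^ Suc j) f y"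
  using assms
proof (induction j arbitrary: x y)
  case 0
  then have "shift_in k x \<xi> = shift_in k y \<xi>" for \<xi>
    by (auto simp: shift_in_def fun_eq_iff)
  then show ?case by (simp add: random_avg_def)
next
  case (Suc j)
  have "(P ^^ Suc j) f (shift_in k x \<xi>) = (P ^^ Suc j) f (shift_in k y \<xi>)" for \<xi>
    using Suc.prems by (intro Suc.IH) (auto simp: shift_in_def)
  then show ?case
    unfolding funpow.simps(2)[of "Suc j"] comp_def by (subst (1 2) random_avg_def) simp
qed

lemma Q_pow_cong:
  assumes "\<And>i. 0 < i \<Longrightarrow> i + Suc j \<le> k \<Longrightarrow> x i = y i"
  shows "(Q ^^ Suc j) f x = (Q ^^ Suc j) f y"
  using assms
proof (induction j arbitrary: x y)
  case 0
  then have "shift_out k x \<xi> = shift_out k y \<xi>" for \<xi>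
    by (auto simp: shift_out_def fun_eq_iff)
  then show ?case by (simp add: random_avg_def)
next
  case (Suc j)
  have "(Q ^^ Suc j) f (shift_out k x \<xi>) = (Q ^^ Suc j) f (shift_out k y \<xi>)" for \<xi>
    using Suc.prems by (intro Suc.IH) (auto simp: shift_out_def)
  then show ?case
    unfolding funpow.simps(2)[of "Suc j"] comp_def by (subst (1 2) random_avg_def) simp
qed

lemma constant_centered_eq_0:
  assumes "\<And>x y. f x = f y" "f \<in> L2_centered M"
  shows "f = (\<lambda>_. 0)"
proof -
  obtain c where c: "f = (\<lambda>_. c)" using assms(1) by (metis ext)
  then show ?thesis using assms(2) W.prob_space by (simp add: L2_centered_def)
qed

text \<open>The k-th power depends on no coordinate at all, and a constant with zero integral is 0.
  Centering is essential, as averages fix constants.\<close>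

lemma P_pow_k: "f \<in> L2_centered M \<Longrightarrow> (P ^^ k) f = (\<lambda>_. 0)"
proof (intro constant_centered_eq_0 S.avg_pow_centered)
  show "(P ^^ k) f x = (P ^^ k) f y" for x y
    using P_pow_cong[of "k - 1" x y f] k_pos by simp
qed

lemma Q_pow_k: "f \<in> L2_centered M \<Longrightarrow> (Q ^^ k) f = (\<lambda>_. 0)"
proof (intro constant_centered_eq_0 T.avg_pow_centered)
  show "(Q ^^ k) f x = (Q ^^ k) f y" for x y
    using Q_pow_cong[of "k - 1" x y f] k_pos by simp
qed

sublocale PQ: adjoint_random_maps M \<nu> "shift_in k" "shift_out k" k
  by unfold_locales (rule inner_P_Q PQP QPQ k_pos P_pow_k Q_pow_k; assumption?)+

end

section \<open>The eigenspace for eigenvalue 1 and its orthogonal complement\<close>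

context iid_window
begin

text \<open>\<open>Q h\<close> witnesses that the choice in \<open>L2_adjoint\<close> is from a
  nonempty set. The difference of the chosen element and \<open>Q h\<close> is centered and
  orthogonal to all centered functions, hence to itself.\<close>

lemma P_adj_AE_eq:
  assumes h: "h \<in> L2_centered M"
  shows "P_adj k \<nu> h \<in> L2_centered M" "AE x in M. P_adj k \<nu> h x = Q h x"
proof -
  let ?adj = "\<lambda>q. q \<in> L2_centered M \<and> (\<forall>f\<in>L2_centered M. L2_inner M (P f) h = L2_inner M f q)"
  define q where "q = P_adj k \<nu> h"
  have Qh: "Q h \<in> L2_centered M" by (rule T.avg_centered[OF h])
  have "?adj (Q h)" using Qh h by (auto intro: inner_P_Q L2_centeredD)
  then have q: "?adj q"
    unfolding q_def P_adj_def L2_adjoint_def P_op_eq by (rule someI[of ?adj])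
  let ?d = "\<lambda>x. q x - Q h x"
  have d: "?d \<in> L2_centered M" using q Qh by (simp add: W.L2_centered_diff)
  have "L2_inner M ?d ?d = L2_inner M ?d q - L2_inner M ?d (Q h)"
    using q Qh d by (intro L2_inner_diff_right L2_centeredD) auto
  also have "\<dots> = 0"
    using q d h inner_P_Q[of ?d h] by (simp add: L2_centeredD)
  finally have "AE x in M. ?d x = 0"
    by (rule L2_inner_self_eq_0[OF L2_centeredD[OF d]])
  then show "AE x in M. P_adj k \<nu> h x = Q h x"
    by (auto simp: q_def)
  show "P_adj k \<nu> h \<in> L2_centered M" using q by (simp add: q_def)
qed

text \<open>Every application of \<open>P_adj\<close> picks its own representative, so agreement
  with Q has to be carried through the powers almost everywhere, along with the centeredness that
  \<open>P_adj_AE_eq\<close> asks for.\<close>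

lemma P_adj_pow_AE_eq:
  assumes f: "f \<in> L2_centered M"
  shows "(P_adj k \<nu> ^^ j) f \<in> L2_centered M \<and> (AE x in M. (P_adj k \<nu> ^^ j) f x = (Q ^^ j) f x)"
proof (induction j)
  case 0
  then show ?case using f by simp
next
  case (Suc j)
  have "AE x in M. Q ((P_adj k \<nu> ^^ j) f) x = Q ((Q ^^ j) f) x"
    using Suc T.avg_pow_centered[OF f]
    by (intro T.avg_cong_AE) (auto intro: L2_spaceD(1) L2_centeredD)
  with P_adj_AE_eq(2) Suc have "AE x in M. (P_adj k \<nu> ^^ Suc j) f x = (Q ^^ Suc j) f x"
    by fastforce
  then show ?case using P_adj_AE_eq(1) Suc by simp
qed

text \<open>The identity term of B cancels against the eigenvalue 1, leaving a vanishing sum of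
  powers. One direction is \<open>PQ.avg_eq_0_if_power_sum_eq_0\<close>; in the other, all positive
  powers vanish once the first ones do.\<close>

lemma B_eigenspace_1_iff:
  "f \<in> B_eigenspace k \<nu> 1 \<longleftrightarrow>
    f \<in> L2_centered M \<and> (AE x in M. P f x = 0) \<and> (AE x in M. Q f x = 0)"
proof (cases "f \<in> L2_centered M")
  case True
  have "AE x in M. \<forall>j\<in>{1..<k}. (P_adj k \<nu> ^^ j) f x = (Q ^^ j) f x"
    using P_adj_pow_AE_eq[OF True] by (simp add: AE_finite_all)
  then have *: "AE x in M. B_op k \<nu> f x = f x + (\<Sum>j\<in>{1..<k}. (P ^^ j) f x + (Q ^^ j) f x)"
    by eventually_elim (simp add: B_op_def P_op_eq)
  have "(AE x in M. B_op k \<nu> f x = 1 * f x)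
      \<longleftrightarrow> (AE x in M. (\<Sum>j\<in>{1..<k}. (P ^^ j) f x + (Q ^^ j) f x) = 0)"
  proof
    assume "AE x in M. B_op k \<nu> f x = 1 * f x"
    with * show "AE x in M. (\<Sum>j\<in>{1..<k}. (P ^^ j) f x + (Q ^^ j) f x) = 0"
      by eventually_elim simp
  next
    assume "AE x in M. (\<Sum>j\<in>{1..<k}. (P ^^ j) f x + (Q ^^ j) f x) = 0"
    with * show "AE x in M. B_op k \<nu> f x = 1 * f x"
      by eventually_elim simp
  qed
  also have "\<dots> \<longleftrightarrow> (AE x in M. P f x = 0) \<and> (AE x in M. Q f x = 0)"
  proof
    assume "(AE x in M. P f x = 0) \<and> (AE x in M. Q f x = 0)"
    then have 0: "AE x in M. P f x = 0" "AE x in M. Q f x = 0" by auto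
    have "AE x in M. (P ^^ j) f x + (Q ^^ j) f x = 0" if "j \<in> {1..<k}" for j
    proof -
      have "0 < j" using that by simp
      show ?thesis
        using S.avg_pow_AE_eq_0[OF True 0(1) \<open>0 < j\<close>] T.avg_pow_AE_eq_0[OF True 0(2) \<open>0 < j\<close>]
        by eventually_elim simp
    qed
    then have "AE x in M. \<forall>j\<in>{1..<k}. (P ^^ j) f x + (Q ^^ j) f x = 0"
      by (simp add: AE_finite_all)
    then show "AE x in M. (\<Sum>j\<in>{1..<k}. (P ^^ j) f x + (Q ^^ j) f x) = 0"
      by eventually_elim simp
  qed (use PQ.avg_eq_0_if_power_sum_eq_0[OF True] in auto)
  finally show ?thesis using True by (simp add: B_eigenspace_def)
qed (simp add: B_eigenspace_def)

lemma B_eigenspace_1_diff: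
  assumes "f \<in> B_eigenspace k \<nu> 1" "g \<in> B_eigenspace k \<nu> 1"
  shows "(\<lambda>x. f x - g x) \<in> B_eigenspace k \<nu> 1"
proof -
  note * = assms[unfolded B_eigenspace_1_iff]
  have int: "integrable M f" "integrable M g"
    using * by (auto intro: W.L2_integrable L2_centeredD)
  have "AE x in M. P (\<lambda>x. f x - g x) x = 0"
    using S.avg_diff[OF int] *[THEN conjunct2, THEN conjunct1] by eventually_elim simp
  moreover have "AE x in M. Q (\<lambda>x. f x - g x) x = 0"
    using T.avg_diff[OF int] *[THEN conjunct2, THEN conjunct2] by eventually_elim simp
  ultimately show ?thesis
    using * by (simp add: B_eigenspace_1_iff W.L2_centered_diff)
qed

text \<open><\<phi>, h> = <Q P \<phi>, h> = <P \<phi>, P h>, and P h = 0 almost everywhere.\<close>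

lemma inner_eq_0_if_indep_last:
  assumes \<phi>: "\<phi> \<in> L2_space M" and h: "h \<in> B_eigenspace k \<nu> 1"
    and indep: "\<And>x \<xi>. \<phi> (x(k := \<xi>)) = \<phi> x"
  shows "L2_inner M \<phi> h = 0"
proof -
  note h = h[unfolded B_eigenspace_1_iff]
  have hL2: "h \<in> L2_space M" using h by (blast intro: L2_centeredD)
  \<comment> \<open>For extensional x the resampled point equals \<open>x(k := \<xi>)\<close>, the
    form that \<open>indep\<close> speaks about.\<close>
  have "Q (P \<phi>) x = \<phi> x" if "x \<in> space M" for x
  proof -
    have "(\<lambda>i\<in>{1..k}. if i < k then x i else \<xi>) = x(k := \<xi>)" for \<xi>
      using that k_pos by (auto simp: space_M PiE_def extensional_def fun_eq_iff)
    then show ?thesis using prob_space by (simp add: QP_eq indep)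
  qed
  then have "L2_inner M \<phi> h = L2_inner M (Q (P \<phi>)) h"
    unfolding L2_inner_def by (intro Bochner_Integration.integral_cong) auto
  also have "\<dots> = L2_inner M (P h) (P \<phi>)"
    using \<phi> hL2 by (simp add: inner_P_Q S.avg_L2 L2_inner_commute[of _ _ h])
  also have "\<dots> = L2_inner M (\<lambda>_. 0) (P \<phi>)"
    using h by (intro L2_inner_cong_AE S.avg_L2 \<phi> hL2 W.L2_space_const) auto
  finally show ?thesis by (simp add: L2_inner_def)
qed

lemma inner_eq_0_if_indep_first:
  assumes \<phi>: "\<phi> \<in> L2_space M" and h: "h \<in> B_eigenspace k \<nu> 1"
    and indep: "\<And>x \<xi>. \<phi> (x(1 := \<xi>)) = \<phi> x"
  shows "L2_inner M \<phi> h = 0"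
proof -
  note h = h[unfolded B_eigenspace_1_iff]
  have hL2: "h \<in> L2_space M" using h by (blast intro: L2_centeredD)
  have "P (Q \<phi>) x = \<phi> x" if "x \<in> space M" for x
  proof -
    have "(\<lambda>i\<in>{1..k}. if i = 1 then \<xi> else x i) = x(1 := \<xi>)" for \<xi>
      using that k_pos by (auto simp: space_M PiE_def extensional_def fun_eq_iff)
    then show ?thesis using prob_space by (simp add: PQ_eq indep del: One_nat_def)
  qed
  then have "L2_inner M \<phi> h = L2_inner M (P (Q \<phi>)) h"
    unfolding L2_inner_def by (intro Bochner_Integration.integral_cong) auto
  also have "\<dots> = L2_inner M (Q \<phi>) (Q h)"
    using \<phi> hL2 by (simp add: inner_P_Q T.avg_L2)
  also have "\<dots> = L2_inner M (Q \<phi>) (\<lambda>_. 0)"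
    using h by (intro L2_inner_cong_AE T.avg_L2 \<phi> hL2 W.L2_space_const) auto
  finally show ?thesis by (simp add: L2_inner_def)
qed

text \<open>The difference p - q lies in the eigenspace, so it is orthogonal to both residuals and
  therefore to their difference, which is p - q up to sign.\<close>

lemma is_L1_component_unique:
  assumes "is_L1_component k \<nu> g p" "is_L1_component k \<nu> g q"
  shows "AE x in M. p x = q x"
proof -
  let ?g = "\<lambda>x. g x - integral\<^sup>L M g" and ?d = "\<lambda>x. p x - q x"
  have pq: "p \<in> B_eigenspace k \<nu> 1" "q \<in> B_eigenspace k \<nu> 1"
    using assms by (auto simp: is_L1_component_def is_orth_proj_def)
  then have d: "?d \<in> B_eigenspace k \<nu> 1" by (rule B_eigenspace_1_diff)
  then have 0: "L2_inner M (\<lambda>x. ?g x - p x) ?d = 0" "L2_inner M (\<lambda>x. ?g x - q x) ?d = 0"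
    using assms by (auto simp: is_L1_component_def is_orth_proj_def)
  have L2: "?g \<in> L2_space M" "p \<in> L2_space M" "q \<in> L2_space M" "?d \<in> L2_space M"
    using assms(1) pq d by (auto simp: is_L1_component_def B_eigenspace_def
        intro: L2_space_diff W.L2_space_const L2_centeredD)
  have "L2_inner M ?d ?d = 0"
    using 0 L2_inner_diff_left[OF L2(1,2,4)] L2_inner_diff_left[OF L2(1,3,4)]
      L2_inner_diff_left[OF L2(2,3,4)] by simp
  from L2_inner_self_eq_0[OF L2(4) this] show ?thesis by simp
qed

end

section \<open>Elementary symmetric polynomials: recursion and integrability\<close>

lemma finite_card_subsets: "finite I \<Longrightarrow> finite {S. S \<subseteq> I \<and> card S = l}"
  by (rule finite_subset[of _ "Pow I"]) auto

lemma elem_sym_fun_upd: "a \<notin> I \<Longrightarrow> elem_sym l I (x(a := \<xi>)) = elem_sym l I x"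
  unfolding elem_sym_def by (intro sum.cong prod.cong refl) auto

text \<open>The index sets are split by whether they contain a; those that do correspond to
  l-subsets of I by removing a.\<close>

lemma elem_sym_insert:
  assumes "finite I" "a \<notin> I"
  shows "elem_sym (Suc l) (insert a I) x = elem_sym (Suc l) I x + x a * elem_sym l I x"
proof -
  let ?C = "\<lambda>l. {S. S \<subseteq> I \<and> card S = l}"
  have fin: "finite S" if "S \<subseteq> I" for S using that assms(1) by (rule finite_subset)
  have "{S. S \<subseteq> insert a I \<and> card S = Suc l} = ?C (Suc l) \<union> insert a ` ?C l" (is "?L = ?R")
  proof
    show "?L \<subseteq> ?R"
    proof
      fix S assume S: "S \<in> ?L"
      show "S \<in> ?R"
      proof (cases "a \<in> S")
        case True
        then have "S = insert a (S - {a})" "S - {a} \<in> ?C l"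
          using S by auto
        then show ?thesis by blast
      qed (use S in auto)
    qed
    show "?R \<subseteq> ?L"
      using assms(2) fin by (auto simp: card_insert_if)
  qed
  moreover have "?C (Suc l) \<inter> insert a ` ?C l = {}"
    using assms(2) by auto
  moreover have "inj_on (insert a) (?C l)"
    using assms(2) by (auto simp: inj_on_def)
  moreover have "(\<Prod>i\<in>insert a S. x i) = x a * (\<Prod>i\<in>S. x i)" if "S \<subseteq> I" for S
    using assms(2) that fin[OF that] by (auto intro: prod.insert)
  ultimately show ?thesis
    using assms(1)
    by (simp add: elem_sym_def sum.union_disjoint finite_card_subsets sum.reindex sum_distrib_left)
qed

context iid_window
begin

lemma L2_prod:
  assumes S: "S \<subseteq> {1..k}"
    and \<phi>: "\<And>i. i \<in> S \<Longrightarrow> \<phi> i \<in> L2_space \<nu>"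
  shows "(\<lambda>x. \<Prod>i\<in>S. \<phi> i (x i)) \<in> L2_space M"
proof -
  \<comment> \<open>Coordinates outside S get the factor 1, so that the product runs over all of
    {1..k} and independence applies.\<close>
  let ?\<psi> = "\<lambda>i t. if i \<in> S then \<phi> i t else 1"
  have prod_eq: "(\<Prod>i\<in>{1..k}. ?\<psi> i (x i)) = (\<Prod>i\<in>S. \<phi> i (x i))" for x :: "nat \<Rightarrow> real"
    using S by (intro prod.mono_neutral_cong_right) auto
  have \<psi>: "integrable \<nu> (?\<psi> i)" "integrable \<nu> (\<lambda>t. (?\<psi> i t)\<^sup>2)" for i
    by (cases "i \<in> S"; simp add: \<phi> L2_integrable L2_spaceD(2))+
  have "integrable M (\<lambda>x. \<Prod>i\<in>{1..k}. ?\<psi> i (x i))"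
    unfolding prod_law_def by (intro W.product_integrable_prod \<psi>) simp
  moreover have "integrable M (\<lambda>x. \<Prod>i\<in>{1..k}. (?\<psi> i (x i))\<^sup>2)"
    unfolding prod_law_def by (rule W.product_integrable_prod[OF _ \<psi>(2)]) simp
  ultimately show ?thesis
    using borel_measurable_integrable
    by (simp add: L2_space_def prod_eq prod_power_distrib[symmetric] del: One_nat_def)
qed

text \<open>Since J and I are disjoint, every monomial involves each coordinate in at most one
  factor, so a finite second moment in each coordinate suffices.\<close>

lemma L2_prod_times_elem_sym:
  assumes JI: "J \<subseteq> {1..k}" "I \<subseteq> {1..k}" "J \<inter> I = {}"
    and \<phi>: "\<And>i. i \<in> J \<Longrightarrow> \<phi> i \<in> L2_space \<nu>"
    and id: "(\<lambda>t. t) \<in> L2_space \<nu>"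
  shows "(\<lambda>x. (\<Prod>i\<in>J. \<phi> i (x i)) * elem_sym l I x) \<in> L2_space M"
proof -
  let ?\<psi> = "\<lambda>i t. if i \<in> J then \<phi> i t else t"
  have \<psi>: "?\<psi> i \<in> L2_space \<nu>" for i
    by (cases "i \<in> J") (simp_all add: \<phi> id)
  have "(\<Prod>i\<in>J. \<phi> i (x i)) * (\<Prod>i\<in>S. x i) = (\<Prod>i\<in>J \<union> S. ?\<psi> i (x i))"
    if "S \<subseteq> I" for S and x :: "nat \<Rightarrow> real"
  proof -
    have "J \<inter> S = {}" "S \<subseteq> {1..k}" using JI that by auto
    moreover have "finite J" "finite S"
      using JI(1) \<open>S \<subseteq> {1..k}\<close> finite_atLeastAtMost by (metis finite_subset)+
    moreover have "(\<Prod>i\<in>S. ?\<psi> i (x i)) = (\<Prod>i\<in>S. x i)"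
      using \<open>J \<inter> S = {}\<close> by (intro prod.cong) auto
    ultimately show ?thesis by (simp add: prod.union_disjoint)
  qed
  then have "(\<lambda>x. (\<Prod>i\<in>J. \<phi> i (x i)) * elem_sym l I x)
      = (\<lambda>x. \<Sum>S\<in>{S. S \<subseteq> I \<and> card S = l}. \<Prod>i\<in>J \<union> S. ?\<psi> i (x i))"
    by (auto simp: fun_eq_iff elem_sym_def sum_distrib_left intro!: sum.cong)
  also have "\<dots> \<in> L2_space M"
    using JI \<psi> by (intro L2_space_sum L2_prod) auto
  finally show ?thesis .
qed

end

section \<open>The component of an elementary symmetric polynomial in the eigenspace\<close>

theorem proposition4p1:
  fixes \<nu> :: "real measure" and \<mu> :: real and k l :: nat
    and g g1 :: "(nat \<Rightarrow> real) \<Rightarrow> real"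
  assumes "real_distribution \<nu>"
    and "integrable \<nu> (\<lambda>x. x\<^sup>2)"
    and "\<mu> = (\<integral>x. x \<partial>\<nu>)"
    and "2 \<le> l" and "l \<le> k"
    and "g = elem_sym l {1..k}"
    and "g1 = (\<lambda>x. (x 1 - \<mu>) * (x k - \<mu>) * elem_sym (l - 2) {2..k - 1} x)"
  shows "is_L1_component k \<nu> g g1 \<and>
    (\<forall>h. is_L1_component k \<nu> g h \<longrightarrow> (AE x in prod_law k \<nu>. h x = g1 x))"
proof -
  interpret real_distribution \<nu> by fact
  interpret iid_window \<nu> k
    using assms(4,5) by unfold_locales simp
  define m where "m = l - 2"
  have l: "l = Suc (Suc m)" and k: "2 \<le> k"
    using assms(4,5) by (auto simp: m_def)
  define K where "K = {2..k - 1}"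
  have K: "K \<subseteq> {1..k}" "finite K" "1 \<notin> K" "k \<notin> K" "insert 1 (insert k K) = {1..k}" "1 \<noteq> k"
    using k by (auto simp: K_def)
  have id_L2: "(\<lambda>t. t) \<in> L2_space \<nu>"
    using assms(2) by (simp add: L2_space_def)
  have "integrable \<nu> (\<lambda>t. t)" using id_L2 by (rule L2_integrable)
  then have mean0: "(\<integral>t. t - \<mu> \<partial>\<nu>) = 0"
    using assms(3) prob_space by simp
  define c where "c = integral\<^sup>L (prod_law k \<nu>) g"
  \<comment> \<open>For j = 0, 1, 2 these have degrees l - 2, l - 1 and l in the intermediate
    variables.\<close>
  let ?e = "\<lambda>j. elem_sym (m + j) K"
  have g_L2: "g \<in> L2_space (prod_law k \<nu>)"
    using L2_prod_times_elem_sym[of "{}" "{1..k}" _ l] id_L2 assms(6) by simp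
  have e_L2: "?e j \<in> L2_space (prod_law k \<nu>)" for j
    using L2_prod_times_elem_sym[of "{}" K _ "m + j"] id_L2 K by simp
  have xe_L2: "(\<lambda>x. x i * ?e j x) \<in> L2_space (prod_law k \<nu>)" if "i = 1 \<or> i = k" for i j
    using L2_prod_times_elem_sym[of "{i}" K "\<lambda>_ t. t" "m + j"] id_L2 K that k_pos by auto
  have g1: "g1 x = (x 1 - \<mu>) * (x k - \<mu>) * ?e 0 x" for x
    by (simp add: assms(7) m_def K_def)
  have g1_L2: "g1 \<in> L2_space (prod_law k \<nu>)"
    using L2_prod_times_elem_sym[of "{1, k}" K "\<lambda>_ t. t - \<mu>" "m + 0"] id_L2 K k_pos
      L2_space_diff[OF id_L2 L2_space_const] by (simp add: g1[abs_def])
  have Pg1: "random_avg \<nu> (shift_in k) g1 = (\<lambda>_. 0)"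
  proof
    fix x
    have "elem_sym (m + 0) K (shift_in k x \<xi>) = elem_sym (m + 0) K (shift_in k x 0)" for \<xi>
    proof -
      have "shift_in k x \<xi> = (shift_in k x 0)(k := \<xi>)"
        using k_pos by (auto simp: shift_in_def fun_eq_iff)
      then show ?thesis using K by (simp add: elem_sym_fun_upd)
    qed
    \<comment> \<open>After the shift the first coordinate is x_2 and the last is
      \<open>\<xi>\<close>, so \<open>\<xi>\<close> enters only through the centered factor, which
      integrates to 0.\<close>
    then have "g1 (shift_in k x \<xi>) = (x 2 - \<mu>) * ?e 0 (shift_in k x 0) * (\<xi> - \<mu>)" for \<xi>
      using k by (simp add: g1 shift_in_def numeral_2_eq_2)
    then show "random_avg \<nu> (shift_in k) g1 x = 0"
      using mean0 by (simp add: random_avg_def)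
  qed
  have Qg1: "random_avg \<nu> (shift_out k) g1 = (\<lambda>_. 0)"
  proof
    fix x
    have "elem_sym (m + 0) K (shift_out k x \<xi>) = elem_sym (m + 0) K (shift_out k x 0)" for \<xi>
    proof -
      have "shift_out k x \<xi> = (shift_out k x 0)(1 := \<xi>)"
        using k_pos by (auto simp: shift_out_def fun_eq_iff)
      then show ?thesis using K by (simp add: elem_sym_fun_upd)
    qed
    then have "g1 (shift_out k x \<xi>) = (x (k - 1) - \<mu>) * ?e 0 (shift_out k x 0) * (\<xi> - \<mu>)" for \<xi>
      using k by (simp add: g1 shift_out_def)
    then show "random_avg \<nu> (shift_out k) g1 x = 0"
      using mean0 by (simp add: random_avg_def)
  qed
  \<comment> \<open>P preserves integrals and annihilates \<open>g1\<close>.\<close>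
  have "integral\<^sup>L (prod_law k \<nu>) g1 = 0"
    using S.integral_avg[OF W.L2_integrable[OF g1_L2]] Pg1 by simp
  then have g1_eigen: "g1 \<in> B_eigenspace k \<nu> 1"
    using g1_L2 Pg1 Qg1 by (simp add: B_eigenspace_1_iff L2_centered_def)
  \<comment> \<open>Expanding g - c - g1, the x_1 x_k terms cancel. The remaining terms containing
    x_k form \<open>\<psi>\<close>, which is free of x_1; all others, including the constant c, form
    \<open>\<phi>\<close>, which is free of x_k.\<close>
  define \<phi> where "\<phi> = (\<lambda>x. \<mu> * (x 1 * ?e 0 x) + x 1 * ?e 1 x - \<mu>\<^sup>2 * ?e 0 x + ?e 2 x - c)"
  define \<psi> where "\<psi> = (\<lambda>x. \<mu> * (x k * ?e 0 x) + x k * ?e 1 x)"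
  have \<phi>_L2: "\<phi> \<in> L2_space (prod_law k \<nu>)" and \<psi>_L2: "\<psi> \<in> L2_space (prod_law k \<nu>)"
    unfolding \<phi>_def \<psi>_def
    by (intro L2_space_add L2_space_diff L2_space_scale xe_L2 e_L2 W.L2_space_const; simp)+
  \<comment> \<open>The recursion splits off x_1 first and then x_k from each of the two resulting
    polynomials.\<close>
  have g: "g x = ?e 2 x + x k * ?e 1 x + x 1 * (?e 1 x + x k * ?e 0 x)" for x
    using K elem_sym_insert[of "insert k K" 1 "Suc m" x] elem_sym_insert[of K k "Suc m" x]
      elem_sym_insert[of K k m x]
    by (simp add: assms(6) l)
  have decomp: "g x - c - g1 x = \<phi> x + \<psi> x" for x
    unfolding g g1 \<phi>_def \<psi>_def by (simp add: algebra_simps power2_eq_square)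
  have "L2_inner (prod_law k \<nu>) (\<lambda>x. g x - c - g1 x) h = 0" if h: "h \<in> B_eigenspace k \<nu> 1" for h
  proof -
    have "L2_inner (prod_law k \<nu>) \<phi> h = 0"
      using K by (intro inner_eq_0_if_indep_last \<phi>_L2 h) (simp add: \<phi>_def elem_sym_fun_upd)
    moreover have "L2_inner (prod_law k \<nu>) \<psi> h = 0"
      using K by (intro inner_eq_0_if_indep_first \<psi>_L2 h) (simp add: \<psi>_def elem_sym_fun_upd)
    moreover have "h \<in> L2_space (prod_law k \<nu>)"
      using h by (simp add: B_eigenspace_1_iff L2_centeredD)
    ultimately show ?thesis
      by (simp add: decomp L2_inner_add_left \<phi>_L2 \<psi>_L2)
  qed
  then have "is_L1_component k \<nu> g g1"
    using g_L2 g1_eigen by (simp add: is_L1_component_def is_orth_proj_def c_def)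
  then show ?thesis
    using is_L1_component_unique by blast
qed

end
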